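(* Let $T:C_r(L_1)\to C_r(L_2)$ be a mapping. The following statements are equivalent: (a) $T$ is a bi-orthogonality preserving real-linear surjection; (b) there exist a (surjective) homeomorphism $\varphi:L_2\to L_1$ with $\varphi(\mathcal{O}_2)=\mathcal{O}_1$, a function $a_1=\gamma_1+i\gamma_2$ in $C_r(L_2)$ with $a_1(s)\neq0$ for all $s\in L_2$, and a function $a_2=\eta_1+i\eta_2:L_2\to\mathbb{C}$ continuous on $\mathcal{O}_2$ (with $\gamma_1,\gamma_2,\eta_1,\eta_2$ real-valued) with the property that $$0<\inf_{s\in\mathcal{O}_2}\left|\det\begin{pmatrix}\gamma_1(s)&\eta_1(s)\\ \gamma_2(s)&\eta_2(s)\end{pmatrix}\right|\le\sup_{s\in\mathcal{O}_2}\left|\det\begin{pmatrix}\gamma_1(s)&\eta_1(s)\\ \gamma_2(s)&\eta_2(s)\end{pmatrix}\right|<+\infty,$$ such that $$T(f)(s)=a_1(s)\,\mathrm{Re}\, f(\varphi(s))+a_2(s)\,\mathrm{Im}\, f(\varphi(s))$$ for all $s\in L_2$ and $f\in C_r(L_1)$.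
   Context: For $j=1,2$: $L_j$ is a compact Hausdorff space, $F_j\subseteq L_j$ is a closed subset, $\mathcal{O}_j:=L_j\setminus F_j$, and $C_r(L_j)$ is the real C$^*$-algebra (pointwise operations, complex conjugation as involution, supremum norm) of all continuous functions $f:L_j\to\mathbb{C}$ taking real values on $F_j$. Functions $f,g$ are orthogonal ($f\perp g$) if $fg=0$. A mapping $T$ is bi-orthogonality preserving if $f\perp g\Leftrightarrow T(f)\perp T(g)$ for all $f,g$. The determinant condition is understood to be vacuous when $\mathcal{O}_2=\emptyset$. *)

theory Defs
  imports "HOL-Analysis.Analysis"
begin

text \<open>
  Spaces are abstract topologies, so the empty compact Hausdorff space is allowed. A function on
  \<open>L\<close> is represented by its extensional version (value \<open>undefined\<close> off \<open>topspace L\<close>), so that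
  equality in \<open>C_r L F\<close> is pointwise equality on \<open>topspace L\<close>. The algebra operations below
  are the pointwise ones, restricted to \<open>topspace L\<close> for the same reason.
\<close>

definition C_r :: "'a topology \<Rightarrow> 'a set \<Rightarrow> ('a \<Rightarrow> complex) set" where
  "C_r L F = {f \<in> extensional (topspace L).
      continuous_map L euclidean f \<and> (\<forall>s\<in>F. f s \<in> \<real>)}"

definition fn_zero :: "'a topology \<Rightarrow> 'a \<Rightarrow> complex" where
  "fn_zero L = (\<lambda>s\<in>topspace L. 0)"

definition fn_add :: "'a topology \<Rightarrow> ('a \<Rightarrow> complex) \<Rightarrow> ('a \<Rightarrow> complex) \<Rightarrow> 'a \<Rightarrow> complex" where
  "fn_add L f g = (\<lambda>s\<in>topspace L. f s + g s)"

definition fn_scaleR :: "'a topology \<Rightarrow> real \<Rightarrow> ('a \<Rightarrow> complex) \<Rightarrow> 'a \<Rightarrow> complex" where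
  "fn_scaleR L r f = (\<lambda>s\<in>topspace L. of_real r * f s)"

definition fn_mult :: "'a topology \<Rightarrow> ('a \<Rightarrow> complex) \<Rightarrow> ('a \<Rightarrow> complex) \<Rightarrow> 'a \<Rightarrow> complex" where
  "fn_mult L f g = (\<lambda>s\<in>topspace L. f s * g s)"

definition fn_orthogonal :: "'a topology \<Rightarrow> ('a \<Rightarrow> complex) \<Rightarrow> ('a \<Rightarrow> complex) \<Rightarrow> bool" where
  "fn_orthogonal L f g \<longleftrightarrow> fn_mult L f g = fn_zero L"

definition real_linear_C_r ::
  "'a topology \<Rightarrow> 'a set \<Rightarrow> 'b topology \<Rightarrow> (('a \<Rightarrow> complex) \<Rightarrow> ('b \<Rightarrow> complex)) \<Rightarrow> bool" where
  "real_linear_C_r L1 F1 L2 T \<longleftrightarrow>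
     (\<forall>f\<in>C_r L1 F1. \<forall>g\<in>C_r L1 F1. T (fn_add L1 f g) = fn_add L2 (T f) (T g)) \<and>
     (\<forall>r. \<forall>f\<in>C_r L1 F1. T (fn_scaleR L1 r f) = fn_scaleR L2 r (T f))"

definition biorthogonality_preserving ::
  "'a topology \<Rightarrow> 'a set \<Rightarrow> 'b topology \<Rightarrow> (('a \<Rightarrow> complex) \<Rightarrow> ('b \<Rightarrow> complex)) \<Rightarrow> bool" where
  "biorthogonality_preserving L1 F1 L2 T \<longleftrightarrow>
     (\<forall>f\<in>C_r L1 F1. \<forall>g\<in>C_r L1 F1. fn_orthogonal L1 f g \<longleftrightarrow> fn_orthogonal L2 (T f) (T g))"

text \<open>
  The absolute value of the determinant whose columns are the real and imaginary parts of
  \<open>a1 s\<close> and of \<open>a2 s\<close>. It is \<open>ereal\<close>-valued because the real-valued \<open>Sup\<close> does not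
  detect unboundedness.
\<close>

definition abs_det :: "('b \<Rightarrow> complex) \<Rightarrow> ('b \<Rightarrow> complex) \<Rightarrow> 'b \<Rightarrow> ereal" where
  "abs_det a1 a2 s =
     ereal \<bar>det (vector [vector [Re (a1 s), Re (a2 s)],
                          vector [Im (a1 s), Im (a2 s)]] :: real^2^2)\<bar>"

end

theory Submission
  imports Defs
begin

text \<open>
  Consider first a map of the described form. Its coefficients form an invertible real matrix at each
  point off the closed set, so \<open>T f s = 0\<close> exactly when \<open>f (\<phi> s) = 0\<close>, and orthogonality is
  preserved both ways. Solving \<open>T f = g\<close> by Cramer's rule gives \<open>Im f\<close> as a quotient of determinants;
  it tends to \<open>0\<close> at the closed set because the numerator does and the denominator is bounded away
  from \<open>0\<close>. For \<open>Re f\<close> the product \<open>a2 \<sqdot> Im f\<close> has to be continuous across the boundary of the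
  closed set, and it is, being itself the image under \<open>T\<close> of a function of the algebra
  (\<open>T_surjective\<close>).

  For the converse, an orthogonality preserving linear bijection \<open>T\<close> with inverse \<open>S\<close> is studied;
  the hypotheses are symmetric in \<open>T\<close> and \<open>S\<close>, so every fact about \<open>T\<close> holds for \<open>S\<close> too.
  Compactness yields for each \<open>s\<close> a point \<open>\<phi> s\<close> such that \<open>T f s\<close> only depends on the germ of \<open>f\<close> at
  \<open>\<phi> s\<close> (\<open>ex_supported_at\<close>); the corresponding map for \<open>S\<close> is inverse to \<open>\<phi>\<close>, and both are
  continuous. The decisive step (\<open>T_eq_0_if_0\<close>) replaces the germ by the value: if \<open>f (\<phi> s) = 0\<close> but
  \<open>T f s \<noteq> 0\<close>, then \<open>f\<close> takes arbitrarily small nonzero values at points where \<open>T f\<close> stays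
  away from \<open>0\<close>, and amplifying \<open>f\<close> near such points by rapidly growing factors gives a function of the
  algebra with unbounded image. This is where completeness of the algebra enters.

  Hence \<open>T f s\<close> is a real-linear function of \<open>f (\<phi> s)\<close>, injective by symmetry. The possible values
  of \<open>f (\<phi> s)\<close> form \<open>\<real>\<close> on the closed set and all of \<open>\<complex>\<close> off it, so comparing
  dimensions shows that \<open>\<phi>\<close> respects the closed sets, and the images of \<open>1\<close> and \<open>\<i>\<close> are the two
  coefficients. A second series argument bounds \<open>a2\<close>, hence the determinant; the lower bound is the
  upper bound for \<open>S\<close>, whose coefficient matrix is the inverse one.
\<close>

section \<open>Real function algebras on compact spaces\<close>

lemma continuous_map_euclidean_iff_tendsto:
  "continuous_map X euclidean f \<longleftrightarrow> (\<forall>x\<in>topspace X. (f \<longlongrightarrow> f x) (atin X x))"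
  by (simp add: continuous_map_atin)

lemma continuous_map_tendstoD:
  "continuous_map X euclidean f \<Longrightarrow> x \<in> topspace X \<Longrightarrow> (f \<longlongrightarrow> f x) (atin X x)"
  by (simp add: continuous_map_atin)

lemma openin_tendsto_subtopology:
  assumes "openin X U" "continuous_map (subtopology X U) euclidean f" "x \<in> U"
  shows "(f \<longlongrightarrow> f x) (atin X x)"
proof (rule topological_tendstoI)
  fix S assume "open S" "f x \<in> S"
  have "openin (subtopology X U) {y \<in> topspace (subtopology X U). f y \<in> S}"
    using assms(2) \<open>open S\<close> by (intro openin_continuous_map_preimage) auto
  then have *: "openin X {y \<in> topspace (subtopology X U). f y \<in> S}"
    using assms(1) by (rule openin_trans_full)
  have "x \<in> {y \<in> topspace (subtopology X U). f y \<in> S}"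
    using assms openin_subset[OF assms(1)] \<open>f x \<in> S\<close> by auto
  with * show "\<forall>\<^sub>F y in atin X x. f y \<in> S"
    unfolding eventually_atin by blast
qed

lemma eventually_atin_topspace: "\<forall>\<^sub>F x in atin X a. x \<in> topspace X"
  unfolding eventually_atin by auto

locale real_on_closed =
  fixes L :: "'a topology" and F :: "'a set"
  assumes compact: "compact_space L"
    and Hausdorff: "Hausdorff_space L"
    and closed: "closedin L F"
begin

lemma F_subset: "F \<subseteq> topspace L"
  using closed closedin_subset by blast

lemma C_r_continuous: "f \<in> C_r L F \<Longrightarrow> continuous_map L euclidean f"
  and C_r_Reals: "f \<in> C_r L F \<Longrightarrow> x \<in> F \<Longrightarrow> f x \<in> \<real>"
  and C_r_extensional: "f \<in> C_r L F \<Longrightarrow> f \<in> extensional (topspace L)"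
  by (auto simp: C_r_def)

lemma C_r_tendsto: "f \<in> C_r L F \<Longrightarrow> x \<in> topspace L \<Longrightarrow> (f \<longlongrightarrow> f x) (atin L x)"
  by (rule continuous_map_tendstoD[OF C_r_continuous])

lemma C_r_restrictI:
  assumes "continuous_map L euclidean f" "\<And>x. x \<in> F \<Longrightarrow> f x \<in> \<real>"
  shows "restrict f (topspace L) \<in> C_r L F"
proof -
  have "continuous_map L euclidean (restrict f (topspace L))"
    using assms(1) by (rule continuous_map_eq) auto
  then show ?thesis
    using assms(2) F_subset by (auto simp: C_r_def)
qed

lemma C_r_restrict_tendstoI:
  assumes "\<And>x. x \<in> topspace L \<Longrightarrow> (f \<longlongrightarrow> f x) (atin L x)" "\<And>x. x \<in> F \<Longrightarrow> f x \<in> \<real>"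
  shows "restrict f (topspace L) \<in> C_r L F"
  using assms by (intro C_r_restrictI) (auto simp: continuous_map_euclidean_iff_tendsto)

lemma C_r_eqI:
  assumes "f \<in> C_r L F" "g \<in> C_r L F" "\<And>x. x \<in> topspace L \<Longrightarrow> f x = g x"
  shows "f = g"
  using assms by (intro extensionalityI[of f "topspace L" g] C_r_extensional)

lemma C_r_const: "(\<lambda>x\<in>topspace L. of_real c) \<in> C_r L F"
  by (intro C_r_restrict_tendstoI) auto

lemma C_r_real: "continuous_map L euclidean h \<Longrightarrow> (\<lambda>x\<in>topspace L. of_real (h x)) \<in> C_r L F"
  by (intro C_r_restrict_tendstoI tendsto_of_real continuous_map_tendstoD Reals_of_real)

lemma C_r_add:
  "f \<in> C_r L F \<Longrightarrow> g \<in> C_r L F \<Longrightarrow> (\<lambda>x\<in>topspace L. f x + g x) \<in> C_r L F"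
  by (intro C_r_restrict_tendstoI tendsto_add C_r_tendsto Reals_add C_r_Reals)

lemma C_r_real_mult:
  assumes "continuous_map L euclidean h" "f \<in> C_r L F"
  shows "(\<lambda>x\<in>topspace L. of_real (h x) * f x) \<in> C_r L F"
  using assms
  by (intro C_r_restrict_tendstoI tendsto_mult tendsto_of_real C_r_tendsto
      continuous_map_tendstoD Reals_mult Reals_of_real C_r_Reals)

lemma C_r_scale:
  "f \<in> C_r L F \<Longrightarrow> (\<lambda>x\<in>topspace L. of_real r * f x) \<in> C_r L F"
  by (rule C_r_real_mult) auto

lemma C_r_bounded:
  assumes "f \<in> C_r L F"
  obtains B where "B > 0" "\<And>x. x \<in> topspace L \<Longrightarrow> norm (f x) \<le> B"
proof -
  have "compact (f ` topspace L)"
    using image_compactin[of L "topspace L" euclidean f] compact C_r_continuous[OF assms]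
    by (simp add: compact_space_def)
  then show ?thesis
    using that compact_imp_bounded[of "f ` topspace L"] unfolding bounded_pos by auto
qed

text \<open>
  Completeness of \<open>C_r L F\<close> in the form of the Weierstrass M-test; both boundedness arguments below
  build their counterexample as such a series.
\<close>
lemma C_r_suminf:
  assumes g: "\<And>n. g n \<in> C_r L F"
    and M: "summable M" "\<And>n x. x \<in> topspace L \<Longrightarrow> norm (g n x) \<le> M n"
  shows "(\<lambda>x\<in>topspace L. \<Sum>n. g n x) \<in> C_r L F"
proof (rule C_r_restrict_tendstoI)
  have sm: "summable (\<lambda>n. g n x)" if "x \<in> topspace L" for x
    using M that by (intro summable_comparison_test[of "\<lambda>n. g n x" M]) auto
  fix x assume x: "x \<in> topspace L"
  show "((\<lambda>x. \<Sum>n. g n x) \<longlongrightarrow> (\<Sum>n. g n x)) (atin L x)"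
  proof (rule swap_uniform_limit')
    show "uniform_limit (topspace L) (\<lambda>n x. \<Sum>i<n. g i x) (\<lambda>x. \<Sum>n. g n x) sequentially"
      using M by (intro Weierstrass_m_test) auto
    show "(\<lambda>n. \<Sum>i<n. g i x) \<longlonglongrightarrow> (\<Sum>n. g n x)"
      using sm[OF x] by (rule summable_LIMSEQ)
    show "\<forall>\<^sub>F n in sequentially. ((\<lambda>x. \<Sum>i<n. g i x) \<longlongrightarrow> (\<Sum>i<n. g i x)) (atin L x)"
      using x g by (intro always_eventually allI tendsto_sum C_r_tendsto)
  qed (auto simp: eventually_atin_topspace)
next
  fix x assume "x \<in> F"
  then have "Im (g n x) = 0" for n
    using C_r_Reals[OF g] complex_is_Real_iff by blast
  moreover have "summable (\<lambda>n. g n x)"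
    using M \<open>x \<in> F\<close> F_subset by (intro summable_comparison_test[of "\<lambda>n. g n x" M]) auto
  ultimately show "(\<Sum>n. g n x) \<in> \<real>"
    by (simp add: complex_is_Real_iff bounded_linear.suminf[OF bounded_linear_Im])
qed

text \<open>
  Urysohn's lemma, sharpened by truncation so that the function is locally constant near the point and
  near the complement of \<open>U\<close>. Germs, not just values, have to be controlled at this stage of the theory.
\<close>
lemma bump_function:
  assumes "openin L U" "x \<in> U"
  obtains h :: "'a \<Rightarrow> real" and V W where
    "continuous_map L euclidean h" "\<And>y. 0 \<le> h y" "\<And>y. h y \<le> 1"
    "openin L V" "x \<in> V" "\<And>y. y \<in> V \<Longrightarrow> h y = 1"
    "openin L W" "topspace L - U \<subseteq> W" "\<And>y. y \<in> W \<Longrightarrow> h y = 0"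
proof -
  have x: "x \<in> topspace L"
    using assms openin_subset by blast
  have "normal_space L"
    using compact Hausdorff compact_Hausdorff_or_regular_imp_normal_space by blast
  moreover have "closedin L {x}"
    using x Hausdorff by (simp add: closedin_Hausdorff_singleton)
  moreover have "closedin L (topspace L - U)"
    using assms by auto
  moreover have "disjnt (topspace L - U) {x}"
    using assms by (auto simp: disjnt_def)
  ultimately obtain k :: "'a \<Rightarrow> real" where "continuous_map L (top_of_set {0..1}) k"
    and k: "k ` (topspace L - U) \<subseteq> {0}" "k ` {x} \<subseteq> {1}"
    by (metis Urysohn_lemma zero_le_one)
  then have cont: "continuous_map L euclidean k"
    by (simp add: continuous_map_in_subtopology)
  \<comment> \<open>This flattens \<open>k\<close> to \<open>1\<close> where \<open>k > 2/3\<close> and to \<open>0\<close> where \<open>k < 1/3\<close>.\<close>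
  define h where "h y = max 0 (min 1 (3 * k y - 1))" for y
  show thesis
  proof
    show "continuous_map L euclidean h"
      unfolding h_def continuous_map_euclidean_iff_tendsto
      by (intro ballI tendsto_max tendsto_min tendsto_diff tendsto_mult tendsto_const
          continuous_map_tendstoD[OF cont])
    show "openin L {y \<in> topspace L. k y \<in> {2/3<..}}"
      using cont by (intro openin_continuous_map_preimage) auto
    show "openin L {y \<in> topspace L. k y \<in> {..<1/3}}"
      using cont by (intro openin_continuous_map_preimage) auto
  qed (use k x in \<open>auto simp: h_def\<close>)
qed

lemma C_r_imaginary:
  assumes "continuous_map L euclideanreal h" "\<And>x. x \<in> F \<Longrightarrow> h x = 0"
  shows "(\<lambda>x\<in>topspace L. \<i> * of_real (h x)) \<in> C_r L F"
  using assms(1) by (intro C_r_restrict_tendstoI tendsto_mult tendsto_const tendsto_of_real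
      continuous_map_tendstoD) (simp_all add: assms(2))

lemma openin_complement: "openin L (topspace L - F)"
  using closed by auto

lemma locally_imaginary_unit:
  assumes "x \<in> topspace L - F"
  obtains f V where "f \<in> C_r L F" "openin L V" "x \<in> V" "V \<subseteq> topspace L - F" "\<And>y. y \<in> V \<Longrightarrow> f y = \<i>"
proof -
  obtain h V W where h: "continuous_map L euclideanreal h" "openin L V" "x \<in> V"
      "\<And>y. y \<in> V \<Longrightarrow> h y = 1" "topspace L - (topspace L - F) \<subseteq> W" "\<And>y. y \<in> W \<Longrightarrow> h y = 0"
    using bump_function[OF openin_complement assms] by metis
  have F: "h y = 0" if "y \<in> F" for y
    using h(5,6) that F_subset by blast
  have V: "V \<subseteq> topspace L - F"
    using h(4) F openin_subset[OF h(2)] by fastforce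
  show thesis
    by (rule that[OF C_r_imaginary[OF h(1) F] h(2,3) V]) (use h(4) V in auto)
qed

end

section \<open>The support map\<close>

text \<open>
  The inverse is carried as a parameter so that the locale is symmetric under exchanging the two sides:
  every fact about \<open>T\<close> transfers to \<open>S\<close> via \<open>inverse_isomorphism\<close> below.
\<close>
locale biorthogonal_isomorphism =
  A: real_on_closed L1 F1 + B: real_on_closed L2 F2
  for L1 :: "'a topology" and F1 and L2 :: "'b topology" and F2 +
  fixes T :: "('a \<Rightarrow> complex) \<Rightarrow> ('b \<Rightarrow> complex)" and S :: "('b \<Rightarrow> complex) \<Rightarrow> ('a \<Rightarrow> complex)"
  assumes T_C_r: "f \<in> C_r L1 F1 \<Longrightarrow> T f \<in> C_r L2 F2"
    and S_C_r: "k \<in> C_r L2 F2 \<Longrightarrow> S k \<in> C_r L1 F1"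
    and S_T: "f \<in> C_r L1 F1 \<Longrightarrow> S (T f) = f"
    and T_S: "k \<in> C_r L2 F2 \<Longrightarrow> T (S k) = k"
    and T_add: "f \<in> C_r L1 F1 \<Longrightarrow> g \<in> C_r L1 F1 \<Longrightarrow>
      T (\<lambda>x\<in>topspace L1. f x + g x) = (\<lambda>s\<in>topspace L2. T f s + T g s)"
    and T_scale: "f \<in> C_r L1 F1 \<Longrightarrow>
      T (\<lambda>x\<in>topspace L1. of_real r * f x) = (\<lambda>s\<in>topspace L2. of_real r * T f s)"
    and T_orth: "f \<in> C_r L1 F1 \<Longrightarrow> g \<in> C_r L1 F1 \<Longrightarrow>
      (\<forall>x\<in>topspace L1. f x * g x = 0) \<longleftrightarrow> (\<forall>s\<in>topspace L2. T f s * T g s = 0)"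
begin

lemma inverse_isomorphism: "biorthogonal_isomorphism L2 F2 L1 F1 S T"
proof unfold_locales
  fix f g :: "'b \<Rightarrow> complex" and r :: real
  assume f: "f \<in> C_r L2 F2"
  have "S (\<lambda>s\<in>topspace L2. of_real r * f s) = S (\<lambda>s\<in>topspace L2. of_real r * T (S f) s)"
    using f by (simp add: T_S)
  also have "\<dots> = S (T (\<lambda>x\<in>topspace L1. of_real r * S f x))"
    using T_scale[of "S f" r] f by (simp add: S_C_r)
  finally show "S (\<lambda>s\<in>topspace L2. of_real r * f s) = (\<lambda>x\<in>topspace L1. of_real r * S f x)"
    using f by (simp add: S_T S_C_r A.C_r_scale)
  assume g: "g \<in> C_r L2 F2"
  have "S (\<lambda>s\<in>topspace L2. f s + g s) = S (\<lambda>s\<in>topspace L2. T (S f) s + T (S g) s)"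
    using f g by (simp add: T_S)
  also have "\<dots> = S (T (\<lambda>x\<in>topspace L1. S f x + S g x))"
    using T_add[of "S f" "S g"] f g by (simp add: S_C_r)
  finally show "S (\<lambda>s\<in>topspace L2. f s + g s) = (\<lambda>x\<in>topspace L1. S f x + S g x)"
    using f g by (simp add: S_T S_C_r A.C_r_add)
  show "(\<forall>s\<in>topspace L2. f s * g s = 0) \<longleftrightarrow> (\<forall>x\<in>topspace L1. S f x * S g x = 0)"
    using T_orth[of "S f" "S g"] f g by (simp add: S_C_r T_S)
qed (auto simp: S_C_r T_C_r S_T T_S)

lemma T_combine:
  assumes "f \<in> C_r L1 F1" "g \<in> C_r L1 F1" "s \<in> topspace L2"
  shows "T (\<lambda>x\<in>topspace L1. f x + of_real r * g x) s = T f s + of_real r * T g s"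
proof -
  have "(\<lambda>x\<in>topspace L1. f x + of_real r * g x)
      = (\<lambda>x\<in>topspace L1. f x + (\<lambda>x\<in>topspace L1. of_real r * g x) x)"
    by auto
  then show ?thesis
    using assms T_add[OF assms(1) A.C_r_scale[OF assms(2), of r]] T_scale[OF assms(2), of r]
    by simp
qed

lemma T_sum:
  assumes "finite I" "\<And>i. i \<in> I \<Longrightarrow> f i \<in> C_r L1 F1" "s \<in> topspace L2"
  shows "T (\<lambda>x\<in>topspace L1. \<Sum>i\<in>I. f i x) s = (\<Sum>i\<in>I. T (f i) s)"
    and "(\<lambda>x\<in>topspace L1. \<Sum>i\<in>I. f i x) \<in> C_r L1 F1"
proof -
  have "T (\<lambda>x\<in>topspace L1. \<Sum>i\<in>I. f i x) s = (\<Sum>i\<in>I. T (f i) s) \<and>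
      (\<lambda>x\<in>topspace L1. \<Sum>i\<in>I. f i x) \<in> C_r L1 F1"
    using assms(1,2)
  proof (induction I)
    case empty
    show ?case
      using T_scale[OF A.C_r_const, of 0 0] A.C_r_const[of 0] assms(3) by (simp add: restrict_def)
  next
    case (insert i I)
    define G where "G = (\<lambda>x\<in>topspace L1. \<Sum>j\<in>I. f j x)"
    have G: "G \<in> C_r L1 F1" "T G s = (\<Sum>i\<in>I. T (f i) s)" and i: "f i \<in> C_r L1 F1"
      using insert unfolding G_def by blast+
    have eq: "(\<lambda>x\<in>topspace L1. \<Sum>j\<in>insert i I. f j x) = (\<lambda>x\<in>topspace L1. f i x + G x)"
      using insert by (auto simp: G_def)
    show ?case
      unfolding eq T_add[OF i G(1)] using G(2) insert.hyps assms(3)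
      by (intro conjI A.C_r_add[OF i G(1)]) simp
  qed
  then show "T (\<lambda>x\<in>topspace L1. \<Sum>i\<in>I. f i x) s = (\<Sum>i\<in>I. T (f i) s)"
    and "(\<lambda>x\<in>topspace L1. \<Sum>i\<in>I. f i x) \<in> C_r L1 F1"
    by auto
qed

text \<open>A function whose image vanishes nowhere; it witnesses that evaluation of \<open>T\<close> at a point is nonzero.\<close>
definition preimage_one :: "'a \<Rightarrow> complex" where
  "preimage_one = S (\<lambda>s\<in>topspace L2. 1)"

lemma preimage_one_C_r: "preimage_one \<in> C_r L1 F1"
  unfolding preimage_one_def using S_C_r[OF B.C_r_const[of 1]] by simp

lemma T_preimage_one: "s \<in> topspace L2 \<Longrightarrow> T preimage_one s = 1"
  unfolding preimage_one_def using T_S[OF B.C_r_const[of 1]] by simp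

text \<open>The functional \<open>f \<mapsto> T f s\<close> has support contained in \<open>{x}\<close>.\<close>
definition supported_at :: "'b \<Rightarrow> 'a \<Rightarrow> bool" where
  "supported_at s x \<longleftrightarrow> x \<in> topspace L1 \<and>
     (\<forall>f\<in>C_r L1 F1. \<forall>V. openin L1 V \<longrightarrow> x \<in> V \<longrightarrow> (\<forall>y\<in>V. f y = 0) \<longrightarrow> T f s = 0)"

text \<open>
  If no point \<open>x\<close> carried the functional, each would have a neighbourhood on which some \<open>f\<close> with
  \<open>T f s \<noteq> 0\<close> vanishes. Every function living on that neighbourhood is orthogonal to \<open>f\<close>, so its image
  vanishes at \<open>s\<close>. By a partition of unity the image of every function would then vanish at \<open>s\<close>.
\<close>
lemma ex_supported_at:
  assumes s: "s \<in> topspace L2"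
  shows "\<exists>x. supported_at s x"
proof (rule ccontr)
  assume none: "\<nexists>x. supported_at s x"
  define P where "P x h U \<longleftrightarrow> continuous_map L1 euclideanreal h \<and> (\<forall>y. 0 \<le> h y) \<and>
      openin L1 U \<and> x \<in> U \<and> (\<forall>y\<in>U. h y = 1) \<and>
      (\<exists>f\<in>C_r L1 F1. T f s \<noteq> 0 \<and> (\<forall>y\<in>topspace L1. h y = 0 \<or> f y = 0))" for x h U
  have "\<exists>h U. P x h U" if "x \<in> topspace L1" for x
  proof -
    obtain f V where f: "f \<in> C_r L1 F1" "openin L1 V" "x \<in> V" "\<forall>y\<in>V. f y = 0" "T f s \<noteq> 0"
      using none \<open>x \<in> topspace L1\<close> unfolding supported_at_def by blast
    obtain h U W where "continuous_map L1 euclideanreal h" "\<And>y. 0 \<le> h y"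
        "openin L1 U" "x \<in> U" "\<And>y. y \<in> U \<Longrightarrow> h y = 1"
        "topspace L1 - V \<subseteq> W" "\<And>y. y \<in> W \<Longrightarrow> h y = 0"
      using A.bump_function[OF f(2,3)] by metis
    then have "P x h U"
      using f unfolding P_def by blast
    then show ?thesis by blast
  qed
  then obtain h U where "\<And>x. x \<in> topspace L1 \<Longrightarrow> P x (h x) (U x)"
    by metis
  then have h_cont: "\<And>x. x \<in> topspace L1 \<Longrightarrow> continuous_map L1 euclideanreal (h x)"
    and h_nonneg: "\<And>x y. x \<in> topspace L1 \<Longrightarrow> 0 \<le> h x y"
    and U: "\<And>x. x \<in> topspace L1 \<Longrightarrow> openin L1 (U x) \<and> x \<in> U x"
    and h_1: "\<And>x y. x \<in> topspace L1 \<Longrightarrow> y \<in> U x \<Longrightarrow> h x y = 1"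
    and h_orth: "\<And>x. x \<in> topspace L1 \<Longrightarrow> 
      \<exists>f\<in>C_r L1 F1. T f s \<noteq> 0 \<and> (\<forall>y\<in>topspace L1. h x y = 0 \<or> f y = 0)"
    unfolding P_def by auto
  have "\<forall>V\<in>U ` topspace L1. openin L1 V" "topspace L1 \<subseteq> \<Union>(U ` topspace L1)"
    using U by auto
  then obtain \<F> where "finite \<F>" "\<F> \<subseteq> U ` topspace L1" "topspace L1 \<subseteq> \<Union>\<F>"
    using A.compact[unfolded compact_space_alt, rule_format, of "U ` topspace L1"] by blast
  then obtain I where I: "finite I" "I \<subseteq> topspace L1" "topspace L1 \<subseteq> \<Union>(U ` I)"
    by (metis finite_subset_image)
  \<comment> \<open>The functions \<open>h i / H\<close> form the partition of unity, as \<open>H \<ge> 1\<close> everywhere.\<close>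
  define H where "H y = (\<Sum>i\<in>I. h i y)" for y
  have H_cont: "continuous_map L1 euclideanreal H"
    unfolding H_def using h_cont I by (intro continuous_map_sum) auto
  have H_pos: "H y > 0" if "y \<in> topspace L1" for y
  proof -
    obtain i where i: "i \<in> I" "y \<in> U i"
      using I \<open>y \<in> topspace L1\<close> by auto
    then have "h i y = 1"
      using I h_1 i by blast
    moreover have "h i y \<le> H y"
      unfolding H_def using i I h_nonneg by (intro member_le_sum) auto
    ultimately show ?thesis by simp
  qed
  define k where "k i = (\<lambda>x\<in>topspace L1. of_real (h i x / H x) * preimage_one x)" for i
  have k_C_r: "k i \<in> C_r L1 F1" if "i \<in> I" for i
    unfolding k_def
  proof (rule A.C_r_real_mult[OF _ preimage_one_C_r])
    have "continuous_map L1 euclideanreal (h i)"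
      using that I h_cont by blast
    then show "continuous_map L1 euclideanreal (\<lambda>x. h i x / H x)"
      using H_cont H_pos by (intro continuous_map_real_divide) (auto simp: less_le)
  qed
  have "preimage_one = (\<lambda>x\<in>topspace L1. \<Sum>i\<in>I. k i x)"
  proof (rule A.C_r_eqI[OF preimage_one_C_r])
    show "(\<lambda>x\<in>topspace L1. \<Sum>i\<in>I. k i x) \<in> C_r L1 F1"
      by (rule T_sum(2)[OF I(1) k_C_r s])
    fix x assume x: "x \<in> topspace L1"
    have "(\<Sum>i\<in>I. k i x) = of_real (\<Sum>i\<in>I. h i x / H x) * preimage_one x"
      unfolding k_def using x by (simp add: sum_distrib_right)
    also have "(\<Sum>i\<in>I. h i x / H x) = 1"
      using H_pos[OF x] by (simp flip: sum_divide_distrib H_def)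
    finally show "preimage_one x = (\<lambda>x\<in>topspace L1. \<Sum>i\<in>I. k i x) x"
      using x by simp
  qed
  then have "1 = (\<Sum>i\<in>I. T (k i) s)"
    using T_sum(1)[OF I(1) k_C_r s] T_preimage_one[OF s] by simp
  moreover have "T (k i) s = 0" if i: "i \<in> I" for i
  proof -
    obtain f where f: "f \<in> C_r L1 F1" "T f s \<noteq> 0" "\<forall>y\<in>topspace L1. h i y = 0 \<or> f y = 0"
      using h_orth i I by blast
    then have "\<forall>x\<in>topspace L1. k i x * f x = 0"
      by (auto simp: k_def)
    then have "T (k i) s * T f s = 0"
      using T_orth[OF k_C_r[OF i] f(1)] s by blast
    then show ?thesis
      using f(2) by simp
  qed
  ultimately show False by simp
qed

definition support_map :: "'b \<Rightarrow> 'a" where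
  "support_map s = (SOME x. supported_at s x)"

lemma support_map: "s \<in> topspace L2 \<Longrightarrow> supported_at s (support_map s)"
  unfolding support_map_def by (rule someI_ex[OF ex_supported_at])

lemma support_map_in: "s \<in> topspace L2 \<Longrightarrow> support_map s \<in> topspace L1"
  using support_map supported_at_def by blast

lemma T_eq_0_if_locally_0:
  assumes "s \<in> topspace L2" "f \<in> C_r L1 F1" "openin L1 V" "support_map s \<in> V"
    and "\<And>y. y \<in> V \<Longrightarrow> f y = 0"
  shows "T f s = 0"
  using support_map[OF assms(1)] assms(2-) unfolding supported_at_def by blast

lemma T_cong_locally:
  assumes s: "s \<in> topspace L2" and "f \<in> C_r L1 F1" "g \<in> C_r L1 F1"
    and V: "openin L1 V" "support_map s \<in> V" "\<And>y. y \<in> V \<Longrightarrow> f y = g y"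
  shows "T f s = T g s"
proof -
  have "(\<lambda>x\<in>topspace L1. f x + of_real (-1) * g x) \<in> C_r L1 F1"
    using A.C_r_add[OF assms(2) A.C_r_scale[OF assms(3), of "-1"]] by (simp cong: restrict_cong)
  then have "T (\<lambda>x\<in>topspace L1. f x + of_real (-1) * g x) s = 0"
    by (rule T_eq_0_if_locally_0[OF s _ V(1,2)]) (use V openin_subset[OF V(1)] in auto)
  then show ?thesis
    using T_combine[OF assms(2,3) s, of "-1"] by simp
qed

text \<open>
  Cutting off \<open>preimage_one\<close> outside a neighbourhood of the support point does not change its image at
  \<open>s\<close>, by the defining property of the support.
\<close>
lemma concentrated_function:
  assumes s: "s \<in> topspace L2" and U: "openin L1 U" "support_map s \<in> U"
  obtains f W where "f \<in> C_r L1 F1" "T f s = 1"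
    "openin L1 W" "topspace L1 - U \<subseteq> W" "\<And>y. y \<in> W \<Longrightarrow> f y = 0"
proof -
  obtain h V W where h: "continuous_map L1 euclideanreal h" "openin L1 V" "support_map s \<in> V"
      "\<And>y. y \<in> V \<Longrightarrow> h y = 1" "openin L1 W" "topspace L1 - U \<subseteq> W" "\<And>y. y \<in> W \<Longrightarrow> h y = 0"
    using A.bump_function[OF U] by metis
  have he: "(\<lambda>x\<in>topspace L1. of_real (h x) * preimage_one x) \<in> C_r L1 F1"
    by (rule A.C_r_real_mult[OF h(1) preimage_one_C_r])
  have "T (\<lambda>x\<in>topspace L1. of_real (h x) * preimage_one x) s = T preimage_one s"
    by (rule T_cong_locally[OF s he preimage_one_C_r h(2,3)]) (use h(4) openin_subset[OF h(2)] in auto)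
  moreover have "(\<lambda>x\<in>topspace L1. of_real (h x) * preimage_one x) y = 0" if "y \<in> W" for y
    using h(7) that openin_subset[OF h(5)] by auto
  ultimately show thesis
    using that[OF he _ h(5,6)] T_preimage_one[OF s] by metis
qed

lemma openin_norm_greater:
  assumes "g \<in> C_r L2 F2"
  shows "openin L2 {s \<in> topspace L2. c < norm (g s)}"
proof -
  have "open {z::complex. c < norm z}"
    by (intro open_Collect_less continuous_intros)
  then show ?thesis
    using openin_continuous_map_preimage[OF B.C_r_continuous[OF assms], of "{z. c < norm z}"]
    by simp
qed

text \<open>
  If \<open>f\<close> is concentrated in \<open>U\<close> and \<open>T f s \<noteq> 0\<close>, then \<open>T f\<close> stays nonzero near \<open>s\<close>, and wherever it is
  nonzero the support point cannot lie in the region where \<open>f\<close> vanishes.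
\<close>
lemma continuous_support_map: "continuous_map L2 L1 support_map"
  unfolding continuous_map_def
proof (intro conjI allI impI)
  show "support_map \<in> topspace L2 \<rightarrow> topspace L1"
    using support_map_in by auto
  fix U assume U: "openin L1 U"
  show "openin L2 {s \<in> topspace L2. support_map s \<in> U}"
  proof (subst openin_subopen, intro ballI)
    fix s assume "s \<in> {s \<in> topspace L2. support_map s \<in> U}"
    then have s: "s \<in> topspace L2" "support_map s \<in> U"
      by auto
    obtain f W where f: "f \<in> C_r L1 F1" "T f s = 1" "openin L1 W" "topspace L1 - U \<subseteq> W"
        "\<And>y. y \<in> W \<Longrightarrow> f y = 0"
      using concentrated_function[OF s(1) U s(2)] by metis
    have "support_map t \<in> U" if "t \<in> topspace L2" "T f t \<noteq> 0" for t
      using T_eq_0_if_locally_0[OF that(1) f(1,3)] f(4,5) support_map_in[OF that(1)] that(2) by blast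
    then have "{t \<in> topspace L2. 0 < norm (T f t)} \<subseteq> {s \<in> topspace L2. support_map s \<in> U}"
      by auto
    moreover have "s \<in> {t \<in> topspace L2. 0 < norm (T f t)}"
      using f s by simp
    ultimately show "\<exists>W. openin L2 W \<and> s \<in> W \<and> W \<subseteq> {s \<in> topspace L2. support_map s \<in> U}"
      using openin_norm_greater[OF T_C_r[OF f(1)], of 0] by blast
  qed
qed

abbreviation inverse_support_map :: "'a \<Rightarrow> 'b" where
  "inverse_support_map \<equiv> biorthogonal_isomorphism.support_map L2 F2 S"

text \<open>
  Otherwise take \<open>f\<close> concentrated near the other point, with \<open>T f\<close> nonzero at \<open>s\<close>, and \<open>g\<close>
  concentrated where \<open>T f \<noteq> 0\<close>, with \<open>S g\<close> nonzero at \<open>x\<close>. A bump \<open>q\<close> at \<open>x\<close> orthogonal to \<open>f\<close>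
  has an image orthogonal to \<open>T f\<close>, hence to \<open>g\<close>; so \<open>q\<close> would be orthogonal to \<open>S g\<close>, although both
  are nonzero at \<open>x\<close>.
\<close>
lemma support_map_inverse:
  assumes x: "x \<in> topspace L1"
  shows "support_map (inverse_support_map x) = x"
proof (rule ccontr)
  interpret inv: biorthogonal_isomorphism L2 F2 L1 F1 S T
    by (rule inverse_isomorphism)
  let ?s = "inv.support_map x"
  assume neq: "support_map ?s \<noteq> x"
  have s: "?s \<in> topspace L2"
    by (rule inv.support_map_in[OF x])
  have "openin L1 (topspace L1 - {x})"
    using A.Hausdorff x by (intro openin_diff) (auto simp: closedin_Hausdorff_singleton)
  moreover have "support_map ?s \<in> topspace L1 - {x}"
    using neq support_map_in[OF s] by simp
  ultimately obtain f W where f: "f \<in> C_r L1 F1" "T f ?s = 1" "openin L1 W"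
      "topspace L1 - (topspace L1 - {x}) \<subseteq> W" "\<And>y. y \<in> W \<Longrightarrow> f y = 0"
    using concentrated_function[OF s] by metis
  have "?s \<in> {t \<in> topspace L2. 0 < norm (T f t)}"
    using f s by simp
  then obtain g V where g: "g \<in> C_r L2 F2" "S g x = 1"
      "topspace L2 - {t \<in> topspace L2. 0 < norm (T f t)} \<subseteq> V" "\<And>t. t \<in> V \<Longrightarrow> g t = 0"
    using inv.concentrated_function[OF x openin_norm_greater[OF T_C_r[OF f(1)], of 0]] by metis
  have "x \<in> W"
    using f(4) x by blast
  then obtain h where h: "continuous_map L1 euclideanreal h" "h x = 1"
      "\<And>y. y \<in> topspace L1 - W \<Longrightarrow> h y = 0"
    using A.bump_function[OF f(3)] by (metis subsetD)
  define q where "q = (\<lambda>x\<in>topspace L1. complex_of_real (h x))"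
  have q: "q \<in> C_r L1 F1"
    unfolding q_def by (rule A.C_r_real[OF h(1)])
  have "\<forall>y\<in>topspace L1. q y * f y = 0"
    using h(3) f(5) by (auto simp: q_def)
  then have "\<forall>t\<in>topspace L2. T q t * T f t = 0"
    using T_orth[OF q f(1)] by blast
  then have "\<forall>t\<in>topspace L2. T q t * g t = 0"
    using g(3,4) by fastforce
  then have "\<forall>y\<in>topspace L1. q y * S g y = 0"
    using T_orth[OF q S_C_r[OF g(1)]] T_S[OF g(1)] by simp
  then show False
    using x h(2) g(2) by (auto simp: q_def)
qed

lemma inverse_support_map_in: "x \<in> topspace L1 \<Longrightarrow> inverse_support_map x \<in> topspace L2"
  by (rule biorthogonal_isomorphism.support_map_in[OF inverse_isomorphism])

lemma inverse_support_map: "s \<in> topspace L2 \<Longrightarrow> inverse_support_map (support_map s) = s"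
  by (rule biorthogonal_isomorphism.support_map_inverse[OF inverse_isomorphism])

lemma homeomorphic_maps_support_map:
  "homeomorphic_maps L2 L1 support_map inverse_support_map"
  using continuous_support_map support_map_inverse inverse_support_map
    biorthogonal_isomorphism.continuous_support_map[OF inverse_isomorphism]
  by (simp add: homeomorphic_maps_def)

section \<open>Vanishing at a single point\<close>

text \<open>
  The passage from germs to values. Suppose \<open>f\<close> vanishes at the support point but \<open>T f s \<noteq> 0\<close>. As
  \<open>f\<close> is not locally zero there, points \<open>y n\<close> can be chosen where \<open>f\<close> is nonzero and at most
  \<open>4\<^sup>-\<^sup>n\<close> in modulus while \<open>T f\<close> is at least \<open>c\<close> in modulus at the corresponding points of \<open>L2\<close>. If moreover the moduli
  decrease by a factor of at least \<open>4\<close>, the points lie in disjoint annuli of \<open>|f|\<close>. Multiplying \<open>f\<close> by \<open>2\<^sup>n\<close>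
  near the level of \<open>y n\<close> still gives a convergent series \<open>G\<close>, and since \<open>G = 2\<^sup>n f\<close> near \<open>y n\<close>
  its image is unbounded, which is impossible on a compact space.
\<close>
lemma T_eq_0_if_0:
  assumes s: "s \<in> topspace L2" and f: "f \<in> C_r L1 F1" and f0: "f (support_map s) = 0"
  shows "T f s = 0"
proof (rule ccontr)
  assume nz: "T f s \<noteq> 0"
  define c where "c = norm (T f s) / 2"
  have c: "c > 0" "c < norm (T f s)"
    using nz by (auto simp: c_def)
  define P where
    "P y \<longleftrightarrow> y \<in> topspace L1 \<and> c < norm (T f (inverse_support_map y)) \<and> f y \<noteq> 0" for y
  have small: "\<exists>y. P y \<and> norm (f y) < \<epsilon>" if "\<epsilon> > 0" for \<epsilon>
  proof (rule ccontr)
    assume none: "\<nexists>y. P y \<and> norm (f y) < \<epsilon>"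
    define N where "N = {y \<in> topspace L1. inverse_support_map y \<in> {t \<in> topspace L2. c < norm (T f t)}}
      \<inter> {y \<in> topspace L1. f y \<in> ball 0 \<epsilon>}"
    have "openin L1 N"
      unfolding N_def
      using homeomorphic_maps_support_map A.C_r_continuous[OF f]
      by (intro openin_Int openin_continuous_map_preimage)
        (auto simp: homeomorphic_maps_def intro!: openin_norm_greater[OF T_C_r[OF f]])
    moreover have "support_map s \<in> N"
      using s f0 c \<open>\<epsilon> > 0\<close> by (simp add: N_def support_map_in inverse_support_map)
    moreover have "f y = 0" if "y \<in> N" for y
      using none that unfolding N_def P_def by auto
    ultimately show False
      using T_eq_0_if_locally_0[OF s f] nz by blast
  qed
  have "\<exists>y. \<forall>n. (P (y n) \<and> norm (f (y n)) \<le> (1/4) ^ n) \<and> norm (f (y (Suc n))) < norm (f (y n)) / 4"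
  proof (rule dependent_nat_choice)
    show "\<exists>y. P y \<and> norm (f y) \<le> (1/4) ^ 0"
      using small[of 1] by force
    fix y n assume "P y \<and> norm (f y) \<le> (1/4) ^ n"
    then have "0 < min (norm (f y) / 4) ((1/4) ^ Suc n)"
      by (simp add: P_def)
    from small[OF this] show "\<exists>z. (P z \<and> norm (f z) \<le> (1/4) ^ Suc n) \<and> norm (f z) < norm (f y) / 4"
      by force
  qed
  then obtain y where P: "\<And>n. P (y n)" and small: "\<And>n. norm (f (y n)) \<le> (1/4) ^ n"
    and decay: "\<And>n. norm (f (y (Suc n))) < norm (f (y n)) / 4"
    by blast
  define r where "r n = norm (f (y n))" for n
  have r_pos: "r n > 0" and y: "y n \<in> topspace L1" for n
    using P[of n] by (auto simp: r_def P_def)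
  have r_less: "r m < r n / 4" if "n < m" for n m
    using that
  proof (induction m)
    case (Suc m)
    show ?case
    proof (cases "n = m")
      case False
      then have "r m < r n / 4"
        using Suc by simp
      moreover have "r (Suc m) < r m / 4"
        using decay[of m] by (simp add: r_def)
      ultimately show ?thesis
        using r_pos[of m] by linarith
    qed (use decay in \<open>simp add: r_def\<close>)
  qed simp
  \<comment> \<open>A cutoff around the level \<open>t = r n\<close>: it is \<open>1\<close> for \<open>|t / r n - 1| \<le> 1/8\<close> and \<open>0\<close> for
    \<open>|t / r n - 1| \<ge> 1/4\<close>, so the cutoffs for different \<open>n\<close> do not overlap.\<close>
  define b where "b n t = max 0 (min 1 (2 - 8 * \<bar>t / r n - 1\<bar>))" for n and t :: real
  have b_01: "0 \<le> b n t" "b n t \<le> 1" for n t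
    by (auto simp: b_def)
  have b_big: "b n t = 0" if "t \<ge> 2 * r n" for n t
  proof -
    have "t / r n \<ge> 2"
      using that r_pos[of n] by (simp add: field_simps)
    then show ?thesis by (simp add: b_def)
  qed
  have b_small: "b n t = 0" if "t \<le> r n / 2" for n t
  proof -
    define q where "q = t / r n"
    have "q \<le> 1 / 2"
      using that r_pos[of n] by (simp add: q_def field_simps)
    then have "2 - 8 * \<bar>q - 1\<bar> \<le> 0"
      by (simp add: abs_if)
    then show ?thesis by (simp add: b_def q_def)
  qed
  define g where "g n = (\<lambda>x\<in>topspace L1. of_real (2 ^ n * b n (norm (f x))) * f x)" for n
  have g: "g n \<in> C_r L1 F1" for n
    unfolding g_def
  proof (rule A.C_r_real_mult[OF _ f])
    have "((\<lambda>x. 2 ^ n * b n (norm (f x))) \<longlongrightarrow> 2 ^ n * b n (norm (f x))) (atin L1 x)"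
      if "x \<in> topspace L1" for x
      unfolding b_def using r_pos[of n] A.C_r_tendsto[OF f that]
      by (intro tendsto_mult tendsto_const tendsto_max tendsto_min tendsto_diff tendsto_rabs
          tendsto_divide tendsto_norm) auto
    then show "continuous_map L1 euclideanreal (\<lambda>x. 2 ^ n * b n (norm (f x)))"
      by (simp add: continuous_map_euclidean_iff_tendsto)
  qed
  have g_le: "norm (g n x) \<le> 2 * (1/2) ^ n" if "x \<in> topspace L1" for n x
  proof (cases "norm (f x) \<ge> 2 * r n")
    case True
    then show ?thesis
      using that b_big by (simp add: g_def)
  next
    case False
    have "norm (g n x) = 2 ^ n * (b n (norm (f x)) * norm (f x))"
      using that b_01(1)[of n "norm (f x)"] by (simp add: g_def norm_mult norm_power)
    also have "\<dots> \<le> 2 ^ n * (1 * (2 * (1/4) ^ n))"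
      using False small[of n] b_01[of n "norm (f x)"]
      by (intro mult_left_mono mult_mono) (auto simp: r_def)
    also have "\<dots> = 2 * (2 ^ n * (1/4) ^ n)"
      by simp
    also have "2 ^ n * (1/4) ^ n = (1/2 :: real) ^ n"
      by (simp flip: power_mult_distrib)
    finally show ?thesis .
  qed
  define G where "G = (\<lambda>x\<in>topspace L1. \<Sum>n. g n x)"
  have G: "G \<in> C_r L1 F1"
    unfolding G_def by (rule A.C_r_suminf[OF g _ g_le]) (auto intro!: summable_mult summable_geometric)
  have TG: "T G (inverse_support_map (y n)) = of_real (2 ^ n) * T f (inverse_support_map (y n))" for n
  proof -
    have s_n: "inverse_support_map (y n) \<in> topspace L2"
      by (rule inverse_support_map_in[OF y])
    let ?V = "{x \<in> topspace L1. f x \<in> {z. \<bar>norm z / r n - 1\<bar> < 1/8}}"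
    have G_near: "G x = (\<lambda>x\<in>topspace L1. of_real (2 ^ n) * f x) x" if "x \<in> ?V" for x
    proof -
      have *: "\<bar>norm (f x) / r n - 1\<bar> < 1/8" and x: "x \<in> topspace L1"
        using that by auto
      then have near: "norm (f x) < 2 * r n" "norm (f x) > r n / 2"
        using r_pos[of n] by (auto simp: abs_if field_simps split: if_splits)
      have "g m x = 0" if "m \<noteq> n" for m
      proof (cases "m < n")
        case True
        then have "b m (norm (f x)) = 0"
          using r_less[of m n] near by (intro b_small) simp
        then show ?thesis
          using x by (simp add: g_def)
      next
        case False
        then have "b m (norm (f x)) = 0"
          using r_less[of n m] near that by (intro b_big) simp
        then show ?thesis
          using x by (simp add: g_def)
      qed
      then have "(\<Sum>m. g m x) = g n x"
        using suminf_finite[of "{n}" "\<lambda>m. g m x"] by simp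
      moreover have "b n (norm (f x)) = 1"
        using * by (simp add: b_def)
      ultimately show ?thesis
        using x by (simp add: G_def g_def)
    qed
    have "open {z::complex. \<bar>norm z / r n - 1\<bar> < 1/8}"
      using r_pos[of n] by (intro open_Collect_less continuous_intros) auto
    then have "openin L1 ?V"
      by (intro openin_continuous_map_preimage[OF A.C_r_continuous[OF f]]) simp
    moreover have "support_map (inverse_support_map (y n)) \<in> ?V"
      using r_pos[of n] y by (simp add: support_map_inverse r_def)
    ultimately have "T G (inverse_support_map (y n))
        = T (\<lambda>x\<in>topspace L1. of_real (2 ^ n) * f x) (inverse_support_map (y n))"
      using T_cong_locally[OF s_n G A.C_r_scale[OF f]] G_near by blast
    then show ?thesis
      using T_scale[OF f, of "2 ^ n"] s_n by simp
  qed
  obtain B where B: "\<And>t. t \<in> topspace L2 \<Longrightarrow> norm (T G t) \<le> B"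
    using B.C_r_bounded[OF T_C_r[OF G]] by metis
  obtain n where n: "B / c < 2 ^ n"
    using real_arch_pow[of 2] by auto
  have "2 ^ n * c \<le> 2 ^ n * norm (T f (inverse_support_map (y n)))"
    using P[of n] by (simp add: P_def)
  also have "\<dots> = norm (T G (inverse_support_map (y n)))"
    by (simp add: TG norm_mult norm_power)
  also have "\<dots> \<le> B"
    by (rule B[OF inverse_support_map_in[OF y]])
  finally show False
    using n c by (simp add: field_simps)
qed

lemma T_eq_0_iff:
  assumes "s \<in> topspace L2" "f \<in> C_r L1 F1"
  shows "T f s = 0 \<longleftrightarrow> f (support_map s) = 0"
  using T_eq_0_if_0[OF assms] support_map_in[OF assms(1)] T_C_r[OF assms(2)]
    biorthogonal_isomorphism.T_eq_0_if_0[OF inverse_isomorphism, of "support_map s" "T f"]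
  by (auto simp: inverse_support_map S_T assms)

lemma T_cong:
  assumes s: "s \<in> topspace L2" and f: "f \<in> C_r L1 F1" "g \<in> C_r L1 F1"
    and eq: "f (support_map s) = g (support_map s)"
  shows "T f s = T g s"
proof -
  have "(\<lambda>x\<in>topspace L1. f x + of_real (-1) * g x) \<in> C_r L1 F1"
    using A.C_r_add[OF f(1) A.C_r_scale[OF f(2), of "-1"]] by (simp cong: restrict_cong)
  then have "T (\<lambda>x\<in>topspace L1. f x + of_real (-1) * g x) s = 0"
    by (rule T_eq_0_if_0[OF s]) (use eq support_map_in[OF s] in simp)
  then show ?thesis
    using T_combine[OF f s, of "-1"] by simp
qed

section \<open>The coefficients\<close>

definition a1 :: "'b \<Rightarrow> complex" where
  "a1 = T (\<lambda>x\<in>topspace L1. 1)"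

text \<open>
  Off \<open>F2\<close> this is the common value at \<open>s\<close> of the images of all functions taking the value \<open>\<i>\<close> at
  the support point (\<open>a2_eq\<close>). No single function serves all \<open>s\<close>, since members of \<open>C_r L1 F1\<close> are real
  on \<open>F1\<close>. On \<open>F2\<close> the value is arbitrary.
\<close>
definition a2 :: "'b \<Rightarrow> complex" where
  "a2 s = T (SOME f. f \<in> C_r L1 F1 \<and> f (support_map s) = \<i>) s"

lemma one_C_r: "(\<lambda>x\<in>topspace L1. 1) \<in> C_r L1 F1"
  using A.C_r_const[of 1] by simp

lemma a1_C_r: "a1 \<in> C_r L2 F2"
  unfolding a1_def by (rule T_C_r[OF one_C_r])

lemma a1_nonzero: "s \<in> topspace L2 \<Longrightarrow> a1 s \<noteq> 0"
  unfolding a1_def using T_eq_0_iff[OF _ one_C_r] support_map_in by simp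

lemma a2_eq:
  assumes "s \<in> topspace L2" "f \<in> C_r L1 F1" "f (support_map s) = \<i>"
  shows "a2 s = T f s"
proof -
  have "\<exists>f. f \<in> C_r L1 F1 \<and> f (support_map s) = \<i>"
    using assms by blast
  from someI_ex[OF this] show ?thesis
    unfolding a2_def using assms by (intro T_cong) auto
qed

text \<open>
  At a point of \<open>F2\<close> all images are real, so the images of a function with value \<open>\<i>\<close> and of the constant
  \<open>1\<close> would be linearly dependent over \<open>\<real>\<close> there; by \<open>T_eq_0_iff\<close> so would be \<open>\<i>\<close> and \<open>1\<close>.
\<close>
lemma support_map_off_F:
  assumes s: "s \<in> topspace L2" and off: "support_map s \<notin> F1"
  shows "s \<notin> F2"
proof
  assume "s \<in> F2"
  obtain f where f: "f \<in> C_r L1 F1" "f (support_map s) = \<i>"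
    using A.locally_imaginary_unit[of "support_map s"] support_map_in[OF s] off by (metis DiffI)
  have real: "of_real (Re (T f s)) = T f s" "of_real (Re (a1 s)) = a1 s"
    using \<open>s \<in> F2\<close> B.C_r_Reals T_C_r[OF f(1)] a1_C_r by auto
  define q where "q = - (Re (T f s) / Re (a1 s))"
  have "T f s + of_real q * a1 s = 0"
    using real a1_nonzero[OF s] unfolding q_def
    by (metis add.right_inverse nonzero_eq_divide_eq minus_mult_left of_real_divide of_real_minus)
  then have "T (\<lambda>x\<in>topspace L1. f x + of_real q * (\<lambda>x\<in>topspace L1. 1) x) s = 0"
    using T_combine[OF f(1) one_C_r s, of q] by (simp add: a1_def)
  moreover have "(\<lambda>x\<in>topspace L1. f x + of_real q * (\<lambda>x\<in>topspace L1. 1) x) \<in> C_r L1 F1"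
    using A.C_r_add[OF f(1) A.C_r_scale[OF one_C_r, of q]] by (simp cong: restrict_cong)
  ultimately have "\<i> + of_real q = 0"
    using T_eq_0_iff[OF s] f(2) support_map_in[OF s] by simp
  then show False
    by (simp add: complex_eq_iff)
qed

lemma support_map_in_F_iff:
  assumes s: "s \<in> topspace L2"
  shows "support_map s \<in> F1 \<longleftrightarrow> s \<in> F2"
  using support_map_off_F[OF s] support_map_in[OF s]
    biorthogonal_isomorphism.support_map_off_F[OF inverse_isomorphism, of "support_map s"]
  by (auto simp: inverse_support_map s)

lemma T_formula:
  assumes s: "s \<in> topspace L2" and f: "f \<in> C_r L1 F1"
  shows "T f s = a1 s * of_real (Re (f (support_map s))) + a2 s * of_real (Im (f (support_map s)))"
proof -
  let ?x = "support_map s" and ?one = "\<lambda>x\<in>topspace L1. 1 :: complex"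
  have x: "?x \<in> topspace L1"
    by (rule support_map_in[OF s])
  show ?thesis
  proof (cases "?x \<in> F1")
    case True
    then have real: "f ?x = of_real (Re (f ?x))"
      using A.C_r_Reals[OF f] by simp
    have "T f s = T (\<lambda>x\<in>topspace L1. of_real (Re (f ?x)) * ?one x) s"
      by (rule T_cong[OF s f A.C_r_scale[OF one_C_r]]) (use real x in simp)
    also have "\<dots> = of_real (Re (f ?x)) * a1 s"
      using T_scale[OF one_C_r, of "Re (f ?x)"] s by (simp add: a1_def)
    finally show ?thesis
      using arg_cong[OF real, of Im] by simp
  next
    case False
    obtain k where k: "k \<in> C_r L1 F1" "k ?x = \<i>"
      using A.locally_imaginary_unit[of ?x] x False by (metis DiffI)
    let ?g = "\<lambda>x\<in>topspace L1. of_real (Re (f ?x)) * ?one x"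
    have g: "?g \<in> C_r L1 F1"
      by (rule A.C_r_scale[OF one_C_r])
    have "(\<lambda>x\<in>topspace L1. ?g x + of_real (Im (f ?x)) * k x) \<in> C_r L1 F1"
      using A.C_r_add[OF g A.C_r_scale[OF k(1), of "Im (f ?x)"]] by (simp cong: restrict_cong)
    then have "T f s = T (\<lambda>x\<in>topspace L1. ?g x + of_real (Im (f ?x)) * k x) s"
      by (rule T_cong[OF s f]) (use x k in \<open>simp add: complex_eq_iff\<close>)
    also have "\<dots> = T ?g s + of_real (Im (f ?x)) * T k s"
      by (rule T_combine[OF g k(1) s])
    also have "T ?g s = of_real (Re (f ?x)) * a1 s"
      using T_scale[OF one_C_r, of "Re (f ?x)"] s by (simp add: a1_def)
    also have "T k s = a2 s"
      using a2_eq[OF s k] by simp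
    finally show ?thesis
      by (simp add: mult.commute)
  qed
qed

text \<open>Locally, a single function with constant value \<open>\<i>\<close> near the support point computes \<open>a2\<close>.\<close>
lemma continuous_a2: "continuous_map (subtopology L2 (topspace L2 - F2)) euclidean a2"
  unfolding continuous_map_euclidean_iff_tendsto
proof
  fix s assume "s \<in> topspace (subtopology L2 (topspace L2 - F2))"
  then have s: "s \<in> topspace L2" "s \<notin> F2"
    by auto
  then have "support_map s \<in> topspace L1 - F1"
    using support_map_in support_map_in_F_iff by auto
  then obtain f V where f: "f \<in> C_r L1 F1" "openin L1 V" "support_map s \<in> V" "\<And>y. y \<in> V \<Longrightarrow> f y = \<i>"
    using A.locally_imaginary_unit by metis
  have V: "openin L2 {t \<in> topspace L2. support_map t \<in> V}"
    by (rule openin_continuous_map_preimage[OF continuous_support_map f(2)])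
  have "\<forall>\<^sub>F t in atin L2 s. T f t = a2 t"
    unfolding eventually_atin using V f s a2_eq[OF _ f(1)] by (auto intro!: exI[of _ "{t \<in> topspace L2. support_map t \<in> V}"])
  moreover have "(T f \<longlongrightarrow> a2 s) (atin L2 s)"
    using B.C_r_tendsto[OF T_C_r[OF f(1)] s(1)] a2_eq[OF s(1) f(1)] f(3,4) by simp
  ultimately have lim: "(a2 \<longlongrightarrow> a2 s) (atin L2 s)"
    by (rule Lim_transform_eventually[rotated])
  have "atin_within L2 s (topspace L2 - F2) \<le> atin L2 s"
    unfolding atin_within_def by (intro inf_mono) auto
  then show "(a2 \<longlongrightarrow> a2 s) (atin (subtopology L2 (topspace L2 - F2)) s)"
    using s by (simp add: atin_subtopology_within tendsto_mono[OF _ lim])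
qed

text \<open>
  The product of \<open>a2\<close> with any real continuous function vanishing on the closed set (transported by the
  support map) is an image under \<open>T\<close>, hence bounded. If \<open>|a2|\<close> exceeded \<open>4\<^sup>n\<close> at \<open>t n\<close>, the sum of
  \<open>2\<^sup>-\<^sup>n\<close> times bumps at the points corresponding to \<open>t n\<close> would contradict this.
\<close>
lemma a2_bounded: "\<exists>K. \<forall>s\<in>topspace L2 - F2. norm (a2 s) \<le> K"
proof (rule ccontr)
  assume "\<nexists>K. \<forall>s\<in>topspace L2 - F2. norm (a2 s) \<le> K"
  then have "\<forall>n::nat. \<exists>s. s \<in> topspace L2 - F2 \<and> norm (a2 s) > 4 ^ n"
    by (metis not_less)
  then obtain t where t: "\<And>n::nat. t n \<in> topspace L2 - F2" "\<And>n. norm (a2 (t n)) > 4 ^ n"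
    by metis
  define P where "P n h \<longleftrightarrow> continuous_map L1 euclideanreal h \<and> (\<forall>y. 0 \<le> h y \<and> h y \<le> 1) \<and>
      h (support_map (t n)) = 1 \<and> (\<forall>y\<in>F1. h y = 0)" for n h
  have "\<exists>h. P n h" for n
  proof -
    have "support_map (t n) \<in> topspace L1 - F1"
      using t(1)[of n] support_map_in support_map_in_F_iff by auto
    then obtain k :: "'a \<Rightarrow> real" and V W where "continuous_map L1 euclideanreal k"
        "\<And>y. 0 \<le> k y" "\<And>y. k y \<le> 1" "support_map (t n) \<in> V" "\<And>y. y \<in> V \<Longrightarrow> k y = 1"
        "topspace L1 - (topspace L1 - F1) \<subseteq> W" "\<And>y. y \<in> W \<Longrightarrow> k y = 0"
      using A.bump_function[OF A.openin_complement] by metis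
    then have "P n k"
      unfolding P_def using A.F_subset by blast
    then show ?thesis by blast
  qed
  then obtain h where "\<And>n. P n (h n)"
    by metis
  then have h: "\<And>n. continuous_map L1 euclideanreal (h n)" "\<And>n y. 0 \<le> h n y" "\<And>n y. h n y \<le> 1"
      "\<And>n. h n (support_map (t n)) = 1" "\<And>n y. y \<in> F1 \<Longrightarrow> h n y = 0"
    unfolding P_def by auto
  define g where "g n = (\<lambda>x\<in>topspace L1. \<i> * of_real ((1/2) ^ n * h n x))" for n
  have g: "g n \<in> C_r L1 F1" for n
    unfolding g_def using h(1,5) by (intro A.C_r_imaginary continuous_map_real_mult) auto
  have g_le: "norm (g n x) \<le> (1/2) ^ n" if "x \<in> topspace L1" for n x
    using that h(2,3)[of n x] by (simp add: g_def norm_mult norm_divide norm_power divide_right_mono power_one_over)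
  define G where "G = (\<lambda>x\<in>topspace L1. \<Sum>n. g n x)"
  have G: "G \<in> C_r L1 F1"
    unfolding G_def by (rule A.C_r_suminf[OF g _ g_le]) (auto intro!: summable_geometric)
  have sm: "summable (\<lambda>n. (1/2) ^ n * h n x)" for x
  proof (rule summable_comparison_test)
    show "\<exists>N. \<forall>n\<ge>N. norm ((1/2) ^ n * h n x) \<le> (1/2) ^ n"
      using h(2,3) by (auto simp: abs_mult mult_left_le)
    show "summable (\<lambda>n. (1/2 :: real) ^ n)"
      by (rule summable_geometric) simp
  qed
  have G_eq: "G x = \<i> * of_real (\<Sum>n. (1/2) ^ n * h n x)" if "x \<in> topspace L1" for x
    using that sm[of x] by (simp add: G_def g_def suminf_mult suminf_of_real del: of_real_mult of_real_power)
  obtain B where B: "\<And>s. s \<in> topspace L2 \<Longrightarrow> norm (T G s) \<le> B"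
    using B.C_r_bounded[OF T_C_r[OF G]] by metis
  obtain n where n: "B < 2 ^ n"
    using real_arch_pow[of 2] by auto
  have s: "t n \<in> topspace L2" "support_map (t n) \<in> topspace L1"
    using t(1)[of n] support_map_in by auto
  let ?\<sigma> = "\<Sum>m. (1/2) ^ m * h m (support_map (t n))"
  have "(1/2) ^ n * h n (support_map (t n)) \<le> ?\<sigma>"
    using sum_le_suminf[OF sm, of "{n}" "support_map (t n)"] h(2) by simp
  then have \<sigma>: "(1/2) ^ n \<le> ?\<sigma>"
    by (simp add: h(4))
  have "2 ^ n = 4 ^ n * (1/2 :: real) ^ n"
    by (simp flip: power_mult_distrib)
  also have "\<dots> \<le> norm (a2 (t n)) * ?\<sigma>"
    using t(2)[of n] \<sigma> by (intro mult_mono) auto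
  also have "\<dots> \<le> norm (a2 (t n)) * \<bar>?\<sigma>\<bar>"
    by (intro mult_left_mono) auto
  also have "\<dots> = norm (T G (t n))"
    using T_formula[OF s(1) G] G_eq[OF s(2)] by (simp add: norm_mult)
  also have "\<dots> \<le> B"
    by (rule B[OF s(1)])
  finally show False
    using n by simp
qed

section \<open>The determinant of the coefficients\<close>

text \<open>The determinant of the real matrix with columns \<open>a1 s\<close> and \<open>a2 s\<close>, under \<open>\<complex> = \<real>\<^sup>2\<close>.\<close>
definition coeff_det :: "'b \<Rightarrow> real" where
  "coeff_det s = Im (cnj (a1 s) * a2 s)"

lemma coeff_det_bounded: "\<exists>K>0. \<forall>s\<in>topspace L2 - F2. \<bar>coeff_det s\<bar> \<le> K"
proof -
  obtain K1 where K1: "K1 > 0" "\<And>s. s \<in> topspace L2 \<Longrightarrow> norm (a1 s) \<le> K1"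
    using B.C_r_bounded[OF a1_C_r] by metis
  obtain K2 where K2: "\<forall>s\<in>topspace L2 - F2. norm (a2 s) \<le> K2"
    using a2_bounded by blast
  have "\<bar>coeff_det s\<bar> \<le> K1 * max K2 1" if "s \<in> topspace L2 - F2" for s
  proof -
    have "\<bar>coeff_det s\<bar> \<le> norm (cnj (a1 s) * a2 s)"
      unfolding coeff_det_def by (rule abs_Im_le_cmod)
    also have "\<dots> = norm (a1 s) * norm (a2 s)"
      by (simp add: norm_mult)
    also have "\<dots> \<le> K1 * max K2 1"
      using K1 K2 that by (intro mult_mono) (auto simp: le_max_iff_disj)
    finally show ?thesis .
  qed
  then show ?thesis
    using K1(1) by (intro exI[of _ "K1 * max K2 1"]) auto
qed

text \<open>
  Evaluating \<open>S (T f) = f\<close> for functions with value \<open>1\<close> and \<open>\<i>\<close> at the support point shows that the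
  coefficient matrices of \<open>S\<close> and \<open>T\<close> at corresponding points are inverse to each other.
\<close>
lemma coeff_det_inverse:
  assumes "s \<in> topspace L2 - F2"
  shows "biorthogonal_isomorphism.coeff_det L2 F2 S (support_map s) * coeff_det s = 1"
proof -
  interpret inv: biorthogonal_isomorphism L2 F2 L1 F1 S T
    by (rule inverse_isomorphism)
  let ?x = "support_map s"
  have s: "s \<in> topspace L2" and x: "?x \<in> topspace L1" "?x \<notin> F1"
    using assms support_map_in support_map_in_F_iff by auto
  obtain k where k: "k \<in> C_r L1 F1" "k ?x = \<i>"
    using A.locally_imaginary_unit[of ?x] x by (metis DiffI)
  have "S (T (\<lambda>x\<in>topspace L1. 1)) ?x
      = inv.a1 ?x * of_real (Re (a1 s)) + inv.a2 ?x * of_real (Im (a1 s))"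
    using inv.T_formula[OF x(1) T_C_r[OF one_C_r]] by (simp add: inverse_support_map s a1_def)
  then have 1: "1 = inv.a1 ?x * of_real (Re (a1 s)) + inv.a2 ?x * of_real (Im (a1 s))"
    using S_T[OF one_C_r] x by simp
  have "S (T k) ?x = inv.a1 ?x * of_real (Re (a2 s)) + inv.a2 ?x * of_real (Im (a2 s))"
    using inv.T_formula[OF x(1) T_C_r[OF k(1)]] a2_eq[OF s k] by (simp add: inverse_support_map s)
  then have 2: "\<i> = inv.a1 ?x * of_real (Re (a2 s)) + inv.a2 ?x * of_real (Im (a2 s))"
    using S_T[OF k(1)] k(2) by simp
  have "inv.coeff_det ?x * coeff_det s
      = Im (cnj (inv.a1 ?x * of_real (Re (a1 s)) + inv.a2 ?x * of_real (Im (a1 s)))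
          * (inv.a1 ?x * of_real (Re (a2 s)) + inv.a2 ?x * of_real (Im (a2 s))))"
    unfolding coeff_det_def inv.coeff_det_def by (simp add: algebra_simps)
  also have "\<dots> = Im (cnj 1 * \<i>)"
    by (simp only: 1 [symmetric] 2 [symmetric])
  finally show ?thesis by simp
qed

text \<open>The upper bound for the inverse map, read through \<open>coeff_det_inverse\<close>.\<close>
lemma coeff_det_bounded_below: "\<exists>c>0. \<forall>s\<in>topspace L2 - F2. c \<le> \<bar>coeff_det s\<bar>"
proof -
  obtain K where K: "K > 0"
    "\<forall>x\<in>topspace L1 - F1. \<bar>biorthogonal_isomorphism.coeff_det L2 F2 S x\<bar> \<le> K"
    using biorthogonal_isomorphism.coeff_det_bounded[OF inverse_isomorphism] by blast
  have "1 / K \<le> \<bar>coeff_det s\<bar>" if s: "s \<in> topspace L2 - F2" for s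
  proof -
    let ?d = "biorthogonal_isomorphism.coeff_det L2 F2 S (support_map s)"
    have "support_map s \<in> topspace L1 - F1"
      using s support_map_in support_map_in_F_iff by auto
    then have "\<bar>?d\<bar> * \<bar>coeff_det s\<bar> \<le> K * \<bar>coeff_det s\<bar>"
      using K by (intro mult_right_mono) auto
    then show ?thesis
      using coeff_det_inverse[OF s] K(1) by (simp add: field_simps flip: abs_mult)
  qed
  then show ?thesis
    using K(1) by (intro exI[of _ "1 / K"]) auto
qed

lemma support_map_image: "support_map ` (topspace L2 - F2) = topspace L1 - F1"
proof
  show "support_map ` (topspace L2 - F2) \<subseteq> topspace L1 - F1"
    using support_map_in support_map_in_F_iff by auto
  show "topspace L1 - F1 \<subseteq> support_map ` (topspace L2 - F2)"
  proof
    fix x assume x: "x \<in> topspace L1 - F1"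
    then show "x \<in> support_map ` (topspace L2 - F2)"
      using inverse_support_map_in[of x] support_map_inverse[of x]
        support_map_in_F_iff[of "inverse_support_map x"]
      by (intro image_eqI[of _ _ "inverse_support_map x"]) auto
  qed
qed

end

section \<open>Weighted composition maps\<close>

text \<open>
  The data of the concrete description, with the lower bound on the determinant in the form of a
  constant \<open>c\<close> that makes sense even if \<open>F2\<close> is the whole space.
\<close>
locale weighted_composition =
  A: real_on_closed L1 F1 + B: real_on_closed L2 F2
  for L1 :: "'a topology" and F1 and L2 :: "'b topology" and F2 +
  fixes \<phi> :: "'b \<Rightarrow> 'a" and \<psi> :: "'a \<Rightarrow> 'b" and a1 a2 :: "'b \<Rightarrow> complex" and c :: real
    and T :: "('a \<Rightarrow> complex) \<Rightarrow> ('b \<Rightarrow> complex)"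
  assumes homeo: "homeomorphic_maps L2 L1 \<phi> \<psi>"
    and image: "\<phi> ` (topspace L2 - F2) = topspace L1 - F1"
    and a1: "a1 \<in> C_r L2 F2" and a1_nonzero: "s \<in> topspace L2 \<Longrightarrow> a1 s \<noteq> 0"
    and a2: "continuous_map (subtopology L2 (topspace L2 - F2)) euclidean a2"
    and c_pos: "c > 0"
    and c_le: "s \<in> topspace L2 - F2 \<Longrightarrow> c \<le> \<bar>Im (cnj (a1 s) * a2 s)\<bar>"
    and T_C_r: "f \<in> C_r L1 F1 \<Longrightarrow> T f \<in> C_r L2 F2"
    and T_eq: "f \<in> C_r L1 F1 \<Longrightarrow> s \<in> topspace L2 \<Longrightarrow>
      T f s = a1 s * of_real (Re (f (\<phi> s))) + a2 s * of_real (Im (f (\<phi> s)))"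
begin

lemma \<phi>_in: "s \<in> topspace L2 \<Longrightarrow> \<phi> s \<in> topspace L1"
  and \<psi>_in: "x \<in> topspace L1 \<Longrightarrow> \<psi> x \<in> topspace L2"
  and \<psi>_\<phi>: "s \<in> topspace L2 \<Longrightarrow> \<psi> (\<phi> s) = s"
  and \<phi>_\<psi>: "x \<in> topspace L1 \<Longrightarrow> \<phi> (\<psi> x) = x"
  and \<psi>_cont: "continuous_map L1 L2 \<psi>"
  using homeo by (auto simp: homeomorphic_maps_def continuous_map_def Pi_iff)

lemma \<phi>_F: "s \<in> F2 \<Longrightarrow> \<phi> s \<in> F1"
proof (rule ccontr)
  assume s: "s \<in> F2" and "\<phi> s \<notin> F1"
  then obtain t where t: "t \<in> topspace L2 - F2" "\<phi> s = \<phi> t"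
    using image \<phi>_in B.F_subset by blast
  then have "s = t"
    using \<psi>_\<phi>[of s] \<psi>_\<phi>[of t] s B.F_subset by auto
  then show False
    using s t by simp
qed

lemma \<psi>_F: "x \<in> F1 \<Longrightarrow> \<psi> x \<in> F2"
  using image \<psi>_in[of x] \<phi>_\<psi>[of x] A.F_subset by (metis DiffD2 DiffI imageI subsetD)

lemma T_eq_0_iff:
  assumes s: "s \<in> topspace L2" and f: "f \<in> C_r L1 F1"
  shows "T f s = 0 \<longleftrightarrow> f (\<phi> s) = 0"
proof
  assume T0: "T f s = 0"
  have "Im (f (\<phi> s)) = 0"
  proof (cases "s \<in> F2")
    case True
    then show ?thesis
      using A.C_r_Reals[OF f \<phi>_F] by (simp add: complex_is_Real_iff)
  next
    case False
    have "Im (cnj (a1 s) * a2 s) * Im (f (\<phi> s)) = Im (cnj (a1 s) * T f s)"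
      unfolding T_eq[OF f s] by (simp add: algebra_simps)
    then show ?thesis
      using T0 c_le[of s] c_pos False s by auto
  qed
  then show "f (\<phi> s) = 0"
    using T0 T_eq[OF f s] a1_nonzero[OF s] by (auto simp: complex_eq_iff)
qed (simp add: T_eq[OF f s])

lemma T_orth:
  assumes "f \<in> C_r L1 F1" "g \<in> C_r L1 F1"
  shows "(\<forall>x\<in>topspace L1. f x * g x = 0) \<longleftrightarrow> (\<forall>s\<in>topspace L2. T f s * T g s = 0)"
proof -
  have "(\<forall>s\<in>topspace L2. T f s * T g s = 0) \<longleftrightarrow> (\<forall>s\<in>topspace L2. f (\<phi> s) * g (\<phi> s) = 0)"
    using T_eq_0_iff assms by simp
  also have "\<dots> \<longleftrightarrow> (\<forall>x\<in>topspace L1. f x * g x = 0)"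
    by (metis \<phi>_in \<psi>_in \<phi>_\<psi>)
  finally show ?thesis ..
qed

text \<open>
  Writing \<open>g = a1 u + a2 v\<close> with real \<open>u\<close> and \<open>v\<close>, Cramer's rule gives \<open>v = N / D\<close> off \<open>F2\<close>.
  On \<open>F2\<close> both \<open>a1\<close> and \<open>g\<close> are real, so \<open>N\<close> vanishes there and \<open>|v| \<le> |N| / c\<close> extends \<open>v\<close>
  continuously by \<open>0\<close>. For \<open>u = (g - a2 v) / a1\<close> continuity of \<open>a2 v\<close> across the boundary of \<open>F2\<close> is
  needed although \<open>a2\<close> is only continuous off \<open>F2\<close>: it holds because \<open>a2 v\<close> is the image of \<open>\<i> v \<circ> \<psi>\<close>.
\<close>
lemma T_surjective:
  assumes g: "g \<in> C_r L2 F2"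
  shows "\<exists>f\<in>C_r L1 F1. T f = g"
proof -
  define D where "D s = Im (cnj (a1 s) * a2 s)" for s
  define N where "N s = Im (cnj (a1 s) * g s)" for s
  have c_D: "c \<le> \<bar>D s\<bar>" if "s \<in> topspace L2 - F2" for s
    using c_le[OF that] by (simp add: D_def)
  define v where "v s = (if s \<in> F2 then 0 else N s / D s)" for s
  have N_lim: "(N \<longlongrightarrow> N s) (atin L2 s)" if "s \<in> topspace L2" for s
    unfolding N_def using that by (intro tendsto_Im tendsto_mult tendsto_cnj B.C_r_tendsto a1 g)
  have N_F: "N s = 0" if "s \<in> F2" for s
    using B.C_r_Reals[OF a1 that] B.C_r_Reals[OF g that] unfolding N_def
    by (simp add: complex_is_Real_iff)
  have v_le: "norm (v s) \<le> norm (N s) / c" if "s \<in> topspace L2" for s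
    using c_D[of s] c_pos that by (auto simp: v_def abs_div intro!: divide_left_mono)
  have v_cont: "continuous_map L2 euclideanreal v"
    unfolding continuous_map_euclidean_iff_tendsto
  proof
    fix s assume s: "s \<in> topspace L2"
    show "(v \<longlongrightarrow> v s) (atin L2 s)"
    proof (cases "s \<in> F2")
      case True
      have "((\<lambda>t. norm (N t) / c) \<longlongrightarrow> norm (N s) / c) (atin L2 s)"
        by (intro tendsto_divide tendsto_norm tendsto_const N_lim[OF s]) (use c_pos in simp)
      then have "((\<lambda>t. norm (N t) / c) \<longlongrightarrow> 0) (atin L2 s)"
        using N_F[OF True] by simp
      then have "(v \<longlongrightarrow> 0) (atin L2 s)"
        by (rule Lim_null_comparison[rotated])
          (rule eventually_mono[OF eventually_atin_topspace v_le])
      then show ?thesis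
        using True by (simp add: v_def)
    next
      case False
      have a2_lim: "(a2 \<longlongrightarrow> a2 s) (atin L2 s)"
        by (rule openin_tendsto_subtopology[OF B.openin_complement a2]) (use False s in auto)
      then have D_lim: "(D \<longlongrightarrow> D s) (atin L2 s)"
        unfolding D_def by (intro tendsto_Im tendsto_mult tendsto_cnj B.C_r_tendsto[OF a1 s] a2_lim)
      have "D s \<noteq> 0"
        using c_D[of s] c_pos False s by auto
      then have lim: "((\<lambda>t. N t / D t) \<longlongrightarrow> N s / D s) (atin L2 s)"
        by (intro tendsto_divide N_lim[OF s] D_lim)
      have "\<forall>\<^sub>F t in atin L2 s. N t / D t = v t"
        unfolding eventually_atin using B.openin_complement False s
        by (intro disjI2 exI[of _ "topspace L2 - F2"]) (auto simp: v_def)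
      then show ?thesis
        using Lim_transform_eventually[OF lim] False by (simp add: v_def)
    qed
  qed
  define f0 where "f0 = (\<lambda>x\<in>topspace L1. \<i> * of_real (v (\<psi> x)))"
  have v\<psi>_cont: "continuous_map L1 euclideanreal (\<lambda>x. v (\<psi> x))"
    using continuous_map_compose[OF \<psi>_cont v_cont] by (simp add: o_def)
  have f0: "f0 \<in> C_r L1 F1"
    unfolding f0_def by (rule A.C_r_imaginary[OF v\<psi>_cont]) (simp add: v_def \<psi>_F)
  have T_f0: "T f0 s = a2 s * of_real (v s)" if "s \<in> topspace L2" for s
    using T_eq[OF f0 that] \<phi>_in[OF that] \<psi>_\<phi>[OF that] by (simp add: f0_def)
  define u where "u s = Re ((g s - T f0 s) / a1 s)" for s
  have u_cont: "continuous_map L2 euclideanreal u"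
    unfolding continuous_map_euclidean_iff_tendsto u_def
    by (intro ballI tendsto_Re tendsto_divide tendsto_diff B.C_r_tendsto g T_C_r f0 a1 a1_nonzero)
  have u_eq: "a1 s * of_real (u s) = g s - T f0 s" if s: "s \<in> topspace L2" for s
  proof -
    have "Im (cnj (a1 s) * (g s - T f0 s)) = N s - v s * D s"
      by (simp add: T_f0[OF s] N_def D_def algebra_simps)
    also have "\<dots> = 0"
      using c_D[of s] c_pos N_F[of s] s by (auto simp: v_def)
    finally have "Im ((g s - T f0 s) / a1 s) = 0"
      by (simp add: Im_divide algebra_simps)
    then have "of_real (u s) = (g s - T f0 s) / a1 s"
      by (simp add: u_def complex_eq_iff)
    then show ?thesis
      using a1_nonzero[OF s] by simp
  qed
  define f where "f = (\<lambda>x\<in>topspace L1. (\<lambda>x\<in>topspace L1. of_real (u (\<psi> x))) x + f0 x)"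
  have "continuous_map L1 euclideanreal (\<lambda>x. u (\<psi> x))"
    using continuous_map_compose[OF \<psi>_cont u_cont] by (simp add: o_def)
  then have f: "f \<in> C_r L1 F1"
    unfolding f_def by (intro A.C_r_add A.C_r_real f0)
  have "T f s = g s" if s: "s \<in> topspace L2" for s
  proof -
    have "f (\<phi> s) = of_real (u s) + \<i> * of_real (v s)"
      using \<phi>_in[OF s] \<psi>_\<phi>[OF s] by (simp add: f_def f0_def)
    then show ?thesis
      using T_eq[OF f s] u_eq[OF s] T_f0[OF s] by simp
  qed
  then have "T f = g"
    by (rule B.C_r_eqI[OF T_C_r[OF f] g])
  then show ?thesis
    using f by blast
qed

lemma T_real_linear: "real_linear_C_r L1 F1 L2 T"
  unfolding real_linear_C_r_def fn_add_def fn_scaleR_def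
proof (intro conjI ballI allI)
  fix f g assume f: "f \<in> C_r L1 F1" and g: "g \<in> C_r L1 F1"
  show "T (\<lambda>x\<in>topspace L1. f x + g x) = (\<lambda>s\<in>topspace L2. T f s + T g s)"
    by (rule B.C_r_eqI) (use f g in \<open>auto simp: A.C_r_add B.C_r_add T_C_r T_eq \<phi>_in algebra_simps\<close>)
next
  fix r f assume f: "f \<in> C_r L1 F1"
  show "T (\<lambda>x\<in>topspace L1. of_real r * f x) = (\<lambda>s\<in>topspace L2. of_real r * T f s)"
    by (rule B.C_r_eqI) (use f in \<open>auto simp: A.C_r_scale B.C_r_scale T_C_r T_eq \<phi>_in algebra_simps\<close>)
qed

end

section \<open>The characterisation\<close>

lemma abs_det_eq: "abs_det a b s = ereal \<bar>Im (cnj (a s) * b s)\<bar>"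
  by (simp add: abs_det_def det_2 mult.commute)

lemma fn_orthogonal_iff: "fn_orthogonal L f g \<longleftrightarrow> (\<forall>x\<in>topspace L. f x * g x = 0)"
  unfolding fn_orthogonal_def fn_mult_def fn_zero_def
  by (auto simp: restrict_def fun_eq_iff)

text \<open>Injectivity is automatic: if \<open>T d = 0\<close>, then \<open>T d\<close> is orthogonal to itself, hence so is \<open>d\<close>, and
  \<open>d\<^sup>2 = 0\<close> forces \<open>d = 0\<close>.\<close>
lemma biorthogonal_isomorphismI:
  assumes "real_on_closed L1 F1" "real_on_closed L2 F2" and maps: "T \<in> C_r L1 F1 \<rightarrow> C_r L2 F2"
    and orth: "biorthogonality_preserving L1 F1 L2 T" and lin: "real_linear_C_r L1 F1 L2 T"
    and surj: "T ` C_r L1 F1 = C_r L2 F2"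
  shows "biorthogonal_isomorphism L1 F1 L2 F2 T (inv_into (C_r L1 F1) T)"
proof -
  interpret A: real_on_closed L1 F1 by fact
  interpret B: real_on_closed L2 F2 by fact
  have T_C_r: "T f \<in> C_r L2 F2" if "f \<in> C_r L1 F1" for f
    using maps that by blast
  have add: "T (\<lambda>x\<in>topspace L1. f x + g x) = (\<lambda>s\<in>topspace L2. T f s + T g s)"
    if "f \<in> C_r L1 F1" "g \<in> C_r L1 F1" for f g
    using lin that unfolding real_linear_C_r_def fn_add_def by blast
  have scale: "T (\<lambda>x\<in>topspace L1. of_real r * f x) = (\<lambda>s\<in>topspace L2. of_real r * T f s)"
    if "f \<in> C_r L1 F1" for f r
    using lin that unfolding real_linear_C_r_def fn_scaleR_def by blast
  have T_orth: "(\<forall>x\<in>topspace L1. f x * g x = 0) \<longleftrightarrow> (\<forall>s\<in>topspace L2. T f s * T g s = 0)"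
    if "f \<in> C_r L1 F1" "g \<in> C_r L1 F1" for f g
    using orth that unfolding biorthogonality_preserving_def fn_orthogonal_iff by blast
  have inj: "inj_on T (C_r L1 F1)"
  proof (rule inj_onI)
    fix f g assume f: "f \<in> C_r L1 F1" and g: "g \<in> C_r L1 F1" and eq: "T f = T g"
    define k where "k = (\<lambda>x\<in>topspace L1. of_real (-1) * g x)"
    define d where "d = (\<lambda>x\<in>topspace L1. f x + k x)"
    have k: "k \<in> C_r L1 F1" and T_k: "T k = (\<lambda>s\<in>topspace L2. of_real (-1) * T g s)"
      unfolding k_def by (rule A.C_r_scale[OF g] scale[OF g])+
    have d: "d \<in> C_r L1 F1" and "T d = (\<lambda>s\<in>topspace L2. T f s + T k s)"
      unfolding d_def by (rule A.C_r_add[OF f k] add[OF f k])+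
    then have "\<forall>s\<in>topspace L2. T d s * T d s = 0"
      by (simp add: T_k eq)
    then have "\<forall>x\<in>topspace L1. d x = 0"
      using T_orth[OF d d] by simp
    then show "f = g"
      by (intro A.C_r_eqI[OF f g]) (simp add: d_def k_def)
  qed
  show ?thesis
  proof unfold_locales
    show "inv_into (C_r L1 F1) T k \<in> C_r L1 F1" if "k \<in> C_r L2 F2" for k
      by (rule inv_into_into) (use that surj in simp)
    show "inv_into (C_r L1 F1) T (T f) = f" if "f \<in> C_r L1 F1" for f
      by (rule inv_into_f_f[OF inj that])
    show "T (inv_into (C_r L1 F1) T k) = k" if "k \<in> C_r L2 F2" for k
      by (rule f_inv_into_f[of _ T "C_r L1 F1"]) (use that surj in simp)
  qed (fact T_C_r add scale T_orth)+
qed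

theorem theorem3p9:
  fixes L1 :: "'a topology" and L2 :: "'b topology"
    and F1 :: "'a set" and F2 :: "'b set"
    and T :: "('a \<Rightarrow> complex) \<Rightarrow> ('b \<Rightarrow> complex)"
  assumes "compact_space L1" and "Hausdorff_space L1" and "closedin L1 F1"
    and "compact_space L2" and "Hausdorff_space L2" and "closedin L2 F2"
    and "T \<in> C_r L1 F1 \<rightarrow> C_r L2 F2"
  shows "(biorthogonality_preserving L1 F1 L2 T \<and> real_linear_C_r L1 F1 L2 T \<and>
            T ` C_r L1 F1 = C_r L2 F2)
     \<longleftrightarrow>
         (\<exists>(\<phi> :: 'b \<Rightarrow> 'a) (a1 :: 'b \<Rightarrow> complex) (a2 :: 'b \<Rightarrow> complex).
            homeomorphic_map L2 L1 \<phi> \<and>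
            \<phi> ` (topspace L2 - F2) = topspace L1 - F1 \<and>
            a1 \<in> C_r L2 F2 \<and> (\<forall>s\<in>topspace L2. a1 s \<noteq> 0) \<and>
            continuous_map (subtopology L2 (topspace L2 - F2)) euclidean a2 \<and>
            (topspace L2 - F2 \<noteq> {} \<longrightarrow>
               0 < (INF s\<in>topspace L2 - F2. abs_det a1 a2 s) \<and>
               (INF s\<in>topspace L2 - F2. abs_det a1 a2 s)
                 \<le> (SUP s\<in>topspace L2 - F2. abs_det a1 a2 s) \<and>
               (SUP s\<in>topspace L2 - F2. abs_det a1 a2 s) < \<infinity>) \<and>
            (\<forall>f\<in>C_r L1 F1. \<forall>s\<in>topspace L2.
               T f s = a1 s * of_real (Re (f (\<phi> s))) + a2 s * of_real (Im (f (\<phi> s)))))"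
    (is "?orth \<and> ?lin \<and> ?surj \<longleftrightarrow> ?weighted")
proof
  interpret A: real_on_closed L1 F1
    using assms by unfold_locales
  interpret B: real_on_closed L2 F2
    using assms by unfold_locales
  {
    assume "?orth \<and> ?lin \<and> ?surj"
    then interpret biorthogonal_isomorphism L1 F1 L2 F2 T "inv_into (C_r L1 F1) T"
      using assms(7) A.real_on_closed_axioms B.real_on_closed_axioms
      by (intro biorthogonal_isomorphismI) auto
    let ?inf = "INF s\<in>topspace L2 - F2. abs_det a1 a2 s"
    let ?sup = "SUP s\<in>topspace L2 - F2. abs_det a1 a2 s"
    have inf_pos: "0 < ?inf"
    proof -
      obtain c where c: "c > 0" "\<forall>s\<in>topspace L2 - F2. c \<le> \<bar>coeff_det s\<bar>"
        using coeff_det_bounded_below by blast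
      have "ereal c \<le> ?inf"
        using c(2) by (intro INF_greatest) (simp add: abs_det_eq coeff_det_def)
      moreover have "0 < ereal c"
        using c(1) by simp
      ultimately show ?thesis
        by (rule less_le_trans[rotated])
    qed
    have sup_finite: "?sup < \<infinity>"
    proof -
      obtain K where "\<forall>s\<in>topspace L2 - F2. \<bar>coeff_det s\<bar> \<le> K"
        using coeff_det_bounded by blast
      then have "?sup \<le> ereal K"
        by (intro SUP_least) (simp add: abs_det_eq coeff_det_def)
      also have "ereal K < \<infinity>"
        by simp
      finally show ?thesis .
    qed
    show ?weighted
      by (intro exI[of _ support_map] exI[of _ a1] exI[of _ a2] conjI impI ballI
          homeomorphic_maps_imp_map[OF homeomorphic_maps_support_map] support_map_image a1_C_r
          a1_nonzero continuous_a2 inf_pos sup_finite INF_le_SUP T_formula)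
  next
    assume ?weighted
    then obtain \<phi> a1 a2 where w: "homeomorphic_map L2 L1 \<phi>"
        "\<phi> ` (topspace L2 - F2) = topspace L1 - F1"
        "a1 \<in> C_r L2 F2" "\<And>s. s \<in> topspace L2 \<Longrightarrow> a1 s \<noteq> 0"
        "continuous_map (subtopology L2 (topspace L2 - F2)) euclidean a2"
        "topspace L2 - F2 \<noteq> {} \<longrightarrow> 0 < (INF s\<in>topspace L2 - F2. abs_det a1 a2 s)"
        "\<And>f s. f \<in> C_r L1 F1 \<Longrightarrow> s \<in> topspace L2 \<Longrightarrow>
           T f s = a1 s * of_real (Re (f (\<phi> s))) + a2 s * of_real (Im (f (\<phi> s)))"
      by blast
    obtain \<psi> where \<psi>: "homeomorphic_maps L2 L1 \<phi> \<psi>"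
      using w(1) homeomorphic_map_maps by blast
    obtain c where c: "c > 0" "\<And>s. s \<in> topspace L2 - F2 \<Longrightarrow> c \<le> \<bar>Im (cnj (a1 s) * a2 s)\<bar>"
    proof (cases "topspace L2 - F2 = {}")
      case False
      then obtain c where c: "0 < ereal c" "ereal c < (INF s\<in>topspace L2 - F2. abs_det a1 a2 s)"
        using w(6) ereal_dense2 by blast
      have "c \<le> \<bar>Im (cnj (a1 s) * a2 s)\<bar>" if "s \<in> topspace L2 - F2" for s
        using less_INF_D[OF c(2) that] by (simp add: abs_det_eq)
      then show thesis
        using that[of c] c(1) by simp
    qed (use that[of 1] in auto)
    interpret weighted_composition L1 F1 L2 F2 \<phi> \<psi> a1 a2 c T
      by unfold_locales ((rule \<psi> w c; assumption?) | use assms(7) in blast)+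
    have ?orth
      unfolding biorthogonality_preserving_def fn_orthogonal_iff using T_orth by blast
    moreover have ?surj
      using T_surjective T_C_r by blast
    ultimately show "?orth \<and> ?lin \<and> ?surj"
      using T_real_linear by blast
  }
qed

end
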